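(* Let $\beta>0$ and $\Omega=[-a,a]$ (with $a>0$), and consider the one-dimensional discretized problem $$D\varphi+\beta\varphi^3-\lambda\varphi=0,\qquad \tfrac12\left(\tfrac1h-\varphi^{\mathrm T}\varphi\right)=0$$ in the unknowns $\varphi\in\mathbb{R}^n$, $\lambda\in\mathbb{R}$. (i) When $n\ge 3$ is odd and the grid points satisfy $x_1=-x_n,\ x_2=-x_{n-1},\ \dots,\ x_{\frac{n-1}2}=-x_{\frac{n+3}2},\ x_{\frac{n+1}2}=0$, there exists a unique solution $\varphi=(\varphi_1,\dots,\varphi_n)^{\mathrm T}$ with $\varphi_1=-\varphi_n,\ \varphi_2=-\varphi_{n-1},\ \dots,\ \varphi_{\frac{n-1}2}=-\varphi_{\frac{n+3}2},\ \varphi_{\frac{n+1}2}=0$ and $\varphi_j>0$ for $j=1,\dots,\frac{n-1}2$. (ii) When $n$ is even and the grid points satisfy $x_1=-x_n,\ x_2=-x_{n-1},\ \dots,\ x_{\frac n2}=-x_{\frac n2+1}$, there exists a unique solution $\varphi=(\varphi_1,\dots,\varphi_n)^{\mathrm T}$ with $\varphi_1=-\varphi_n,\ \varphi_2=-\varphi_{n-1},\ \dots,\ \varphi_{\frac n2}=-\varphi_{\frac n2+1}$ and $\varphi_j>0$ for $j=1,\dots,\frac n2$.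
   Context: For a vector $\varphi$, $\varphi^3$ denotes the vector of componentwise cubes. The one-dimensional discretized problem on $\Omega=[-a,a]$: $n\in\mathbb{N}^+$, $h=\frac{2a}{n+1}$, $x_j=-a+jh$, $V(x)=\frac12x^2$, $v_j=V(x_j)$ for $j=1,\dots,n$. The matrix $D\in\mathbb{R}^{n\times n}$ is $D=\frac12D_1+\mathrm{diag}(v_1,\dots,v_n)$, where $D_1$ is $\frac1{h^2}$ times the tridiagonal matrix with $2$ on the diagonal and $-1$ on the sub- and superdiagonals. A vector $\varphi$ is called a solution if there is $\lambda\in\mathbb{R}$ such that $(\varphi,\lambda)$ satisfies both equations. *)

theory Defs
  imports Complex_Main "Jordan_Normal_Form.Matrix"
begin

text \<open>
  Vectors and matrices are indexed from 0, whereas the grid points \<open>x\<^sub>1, \<dots>, x\<^sub>n\<close> are numbered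
  from 1: entry \<open>i\<close> of a vector belongs to the grid point with number \<open>i + 1\<close>.
\<close>

definition grid_step :: "real \<Rightarrow> nat \<Rightarrow> real" where
  "grid_step a n = 2 * a / (real n + 1)"

definition grid_point :: "real \<Rightarrow> nat \<Rightarrow> nat \<Rightarrow> real" where
  "grid_point a n j = - a + real j * grid_step a n"

definition potential :: "real \<Rightarrow> real" where
  "potential x = 1 / 2 * x ^ 2"

definition D1_mat :: "real \<Rightarrow> nat \<Rightarrow> real mat" where
  "D1_mat a n = (1 / (grid_step a n) ^ 2) \<cdot>\<^sub>m
     mat n n (\<lambda>(i, j). if i = j then 2 else if i = Suc j \<or> j = Suc i then - 1 else 0)"

definition D_mat :: "real \<Rightarrow> nat \<Rightarrow> real mat" where
  "D_mat a n = (1 / 2) \<cdot>\<^sub>m D1_mat a n + mat_diag n (\<lambda>i. potential (grid_point a n (i + 1)))"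

definition vec_cube :: "real vec \<Rightarrow> real vec" where
  "vec_cube v = map_vec (\<lambda>t. t ^ 3) v"

definition is_solution :: "real \<Rightarrow> real \<Rightarrow> nat \<Rightarrow> real vec \<Rightarrow> bool" where
  "is_solution \<beta> a n \<phi> \<longleftrightarrow> \<phi> \<in> carrier_vec n \<and>
     (\<exists>lam :: real.
        D_mat a n *\<^sub>v \<phi> + \<beta> \<cdot>\<^sub>v vec_cube \<phi> - lam \<cdot>\<^sub>v \<phi> = 0\<^sub>v n \<and>
        1 / 2 * (1 / grid_step a n - \<phi> \<bullet> \<phi>) = 0)"

text \<open>The \<open>j\<close>-th component in numbering from 1; meaningful for \<open>1 \<le> j \<le> dim_vec v\<close> only.\<close>

definition component :: "real vec \<Rightarrow> nat \<Rightarrow> real" where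
  "component v j = v $ (j - 1)"

end

theory Submission
  imports Defs "HOL-Analysis.Function_Topology"
begin

text \<open>
  An antisymmetric vector is determined by its first \<open>n div 2\<close> entries, and these satisfy a
  problem of the same shape, with an extra diagonal contribution in the last row when \<open>n\<close> is even.
  A minimiser of the energy \<open>u \<bullet> A u + \<beta>/2 \<Sum> u\<^sub>i\<^sup>4\<close> on the sphere may be replaced by its
  absolute value because the off-diagonal entries of \<open>A\<close> are nonpositive; the Lagrange equation
  comes from rotating two coordinates, and connectedness of the tridiagonal matrix makes the
  minimiser positive. Two positive solutions are compared at an index where their quotient is
  maximal: the one with the smaller multiplier lies below the other one, so that equal norms force
  equality.
\<close>

section \<open>Nonlinear eigenvalue problems for matrices with nonpositive off-diagonal entries\<close>

text \<open>With the weight \<open>\<beta> / 2\<close> on the quartic part and \<open>A\<close>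
  symmetric, half the gradient is \<open>A u + \<beta> u^3\<close>, the left side of the nonlinear
  eigenvalue equation.\<close>

definition energy :: "'a set \<Rightarrow> ('a \<Rightarrow> 'a \<Rightarrow> real) \<Rightarrow> real \<Rightarrow> ('a \<Rightarrow> real) \<Rightarrow> real" where
  "energy I A \<beta> u = (\<Sum>i\<in>I. \<Sum>j\<in>I. A i j * (u i * u j)) + \<beta> / 2 * (\<Sum>i\<in>I. u i ^ 4)"

text \<open>Energy and sphere see only the coordinates in \<open>I\<close>, so the minimum may be
  sought among functions vanishing outside \<open>I\<close>, where the sphere is compact.\<close>

lemma energy_attains_min_on_sphere:
  fixes A :: "'a \<Rightarrow> 'a \<Rightarrow> real"
  assumes fin: "finite I" and ne: "I \<noteq> {}" and S: "S > 0"
  obtains u where "(\<Sum>i\<in>I. u i ^ 2) = S"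
    and "\<And>w. (\<Sum>i\<in>I. w i ^ 2) = S \<Longrightarrow> energy I A \<beta> u \<le> energy I A \<beta> w"
proof -
  \<comment> \<open>Pinning the other coordinates to 0 makes \<open>B\<close> a product of compact
    sets, hence compact by Tychonoff.\<close>
  define B where "B = PiE UNIV (\<lambda>i. if i \<in> I then {- sqrt S..sqrt S} else {0})"
  define q where "q = (\<lambda>u::'a \<Rightarrow> real. \<Sum>i\<in>I. u i ^ 2)"
  define K where "K = B \<inter> {u. q u = S}"
  have coord: "continuous_on T (\<lambda>u::'a \<Rightarrow> real. u i)" for T i
    by (rule continuous_on_subset[OF continuous_on_product_coordinates]) simp
  have "compactin (product_topology (\<lambda>i. euclidean) UNIV) B"
    unfolding B_def by (subst compactin_PiE) auto
  then have "compact B"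
    by (simp add: euclidean_product_topology)
  moreover have "closed {u. q u = S}"
    unfolding q_def by (intro closed_Collect_eq continuous_intros coord)
  ultimately have K: "compact K"
    unfolding K_def by (rule compact_Int_closed)
  have inK: "\<exists>w'\<in>K. \<forall>i\<in>I. w' i = w i" if w: "(\<Sum>i\<in>I. w i ^ 2) = S" for w :: "'a \<Rightarrow> real"
  proof
    let ?w = "\<lambda>i. if i \<in> I then w i else 0"
    have "w i ^ 2 \<le> S" if "i \<in> I" for i
      unfolding w[symmetric] by (rule member_le_sum[OF that]) (auto simp: fin)
    then have "\<bar>w i\<bar> \<le> sqrt S" if "i \<in> I" for i
      using that by (simp add: real_le_rsqrt)
    then have "?w \<in> B"
      unfolding B_def by (auto simp: abs_le_iff) (metis minus_le_iff)
    then show "?w \<in> K"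
      using w by (simp add: K_def q_def)
  qed auto
  obtain i0 where i0: "i0 \<in> I"
    using ne by blast
  have "(\<Sum>i\<in>I. (if i = i0 then sqrt S else 0) ^ 2) = S"
    using S fin i0 by (simp add: if_distrib[of "\<lambda>x. x ^ 2"] cong: if_cong)
  from inK[OF this] have "K \<noteq> {}"
    by blast
  moreover have "continuous_on K (energy I A \<beta>)"
    unfolding energy_def by (intro continuous_intros coord)
  ultimately obtain u where u: "u \<in> K" "\<And>w. w \<in> K \<Longrightarrow> energy I A \<beta> u \<le> energy I A \<beta> w"
    using continuous_attains_inf[OF K] by blast
  show thesis
  proof
    show "(\<Sum>i\<in>I. u i ^ 2) = S"
      using u(1) by (simp add: K_def q_def)
    show "energy I A \<beta> u \<le> energy I A \<beta> w" if w: "(\<Sum>i\<in>I. w i ^ 2) = S" for w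
    proof -
      obtain w' where w': "w' \<in> K" "\<forall>i\<in>I. w' i = w i"
        using inK[OF w] by blast
      have "energy I A \<beta> w' = energy I A \<beta> w"
        unfolding energy_def using w'(2) by simp
      then show ?thesis
        using u(2)[OF w'(1)] by simp
    qed
  qed
qed

text \<open>Absolute values leave squares and fourth powers alone and can only increase the products
  \<open>u i * u j\<close>, which carry nonpositive coefficients off the diagonal.\<close>

lemma energy_abs_le:
  assumes offdiag: "\<And>i j. i \<in> I \<Longrightarrow> j \<in> I \<Longrightarrow> i \<noteq> j \<Longrightarrow> A i j \<le> 0"
  shows "energy I A \<beta> (\<lambda>i. \<bar>u i\<bar>) \<le> energy I A \<beta> u"
proof -
  have "A i j * (\<bar>u i\<bar> * \<bar>u j\<bar>) \<le> A i j * (u i * u j)" if "i \<in> I" "j \<in> I" for i j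
  proof (cases "i = j")
    case False
    then show ?thesis
      using offdiag[OF that False] abs_ge_self[of "u i * u j"]
      by (intro mult_left_mono_neg) (auto simp: abs_mult)
  qed simp
  then show ?thesis
    unfolding energy_def by (intro add_mono sum_mono) auto
qed

text \<open>A chain rule along a curve \<open>x\<close> with velocity \<open>y\<close>; symmetry of
  \<open>A\<close> merges the two terms of the product rule, whence the factor 2.\<close>

lemma energy_has_derivative_along:
  assumes fin: "finite I"
    and sym: "\<And>i j. i \<in> I \<Longrightarrow> j \<in> I \<Longrightarrow> A i j = A j i"
    and der: "\<And>i. i \<in> I \<Longrightarrow> ((\<lambda>t. x t i) has_real_derivative y i) (at t)"
  shows "((\<lambda>t. energy I A \<beta> (x t)) has_real_derivative
    2 * (\<Sum>i\<in>I. y i * ((\<Sum>j\<in>I. A i j * x t j) + \<beta> * x t i ^ 3))) (at t)"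
proof -
  have "((\<lambda>t. energy I A \<beta> (x t)) has_real_derivative
     (\<Sum>i\<in>I. \<Sum>j\<in>I. A i j * (y i * x t j + y j * x t i))
       + \<beta> / 2 * (\<Sum>i\<in>I. 4 * x t i ^ 3 * y i)) (at t)"
    unfolding energy_def
    by (intro DERIV_add DERIV_sum DERIV_cmult DERIV_mult der)
      (auto intro!: derivative_eq_intros der)
  moreover have "(\<Sum>i\<in>I. \<Sum>j\<in>I. A i j * (y j * x t i)) = (\<Sum>i\<in>I. \<Sum>j\<in>I. A i j * (y i * x t j))"
    by (subst sum.swap) (intro sum.cong refl, simp add: sym)
  ultimately show ?thesis
    by (simp add: algebra_simps sum.distrib sum_distrib_left)
qed

lemma sum_delta2:
  fixes f :: "'a \<Rightarrow> real"
  assumes "finite I" "k \<in> I" "l \<in> I" "k \<noteq> l"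
  shows "(\<Sum>i\<in>I. (if i = k then x else if i = l then y else 0) * f i) = x * f k + y * f l"
proof -
  have "(\<Sum>i\<in>I. (if i = k then x else if i = l then y else 0) * f i)
      = (\<Sum>i\<in>I. (if i = k then x * f i else 0) + (if i = l then y * f i else 0))"
    using assms(4) by (intro sum.cong) auto
  then show ?thesis
    using assms by (simp add: sum.distrib)
qed

text \<open>Rotating the minimiser in a coordinate plane stays on the sphere, so the derivative of
  the energy along the rotation vanishes. Over all planes this says that the half gradient
  \<open>G\<close> is parallel to \<open>u\<close>.\<close>

lemma nonneg_eigenvector_exists:
  fixes A :: "'a \<Rightarrow> 'a \<Rightarrow> real"
  assumes fin: "finite I" and ne: "I \<noteq> {}" and S: "S > 0"
    and sym: "\<And>i j. i \<in> I \<Longrightarrow> j \<in> I \<Longrightarrow> A i j = A j i"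
    and offdiag: "\<And>i j. i \<in> I \<Longrightarrow> j \<in> I \<Longrightarrow> i \<noteq> j \<Longrightarrow> A i j \<le> 0"
  obtains u lam where "\<And>i. u i \<ge> 0" and "(\<Sum>i\<in>I. u i ^ 2) = S"
    and "\<And>i. i \<in> I \<Longrightarrow> (\<Sum>j\<in>I. A i j * u j) + \<beta> * u i ^ 3 = lam * u i"
proof -
  obtain w where w: "(\<Sum>i\<in>I. w i ^ 2) = S"
    and wmin: "\<And>z. (\<Sum>i\<in>I. z i ^ 2) = S \<Longrightarrow> energy I A \<beta> w \<le> energy I A \<beta> z"
    using energy_attains_min_on_sphere[OF fin ne S] by metis
  define u where "u = (\<lambda>i. \<bar>w i\<bar>)"
  have u: "(\<Sum>i\<in>I. u i ^ 2) = S"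
    using w by (simp add: u_def)
  have umin: "energy I A \<beta> u \<le> energy I A \<beta> z" if "(\<Sum>i\<in>I. z i ^ 2) = S" for z
    using wmin[OF that] energy_abs_le[OF offdiag, where u = w and \<beta> = \<beta>] unfolding u_def
    by fastforce
  define G where "G = (\<lambda>i. (\<Sum>j\<in>I. A i j * u j) + \<beta> * u i ^ 3)"
  have crit: "G k * u l = G l * u k" if kl: "k \<in> I" "l \<in> I" for k l
  proof (cases "k = l")
    case False
    \<comment> \<open>\<open>x t\<close> is \<open>u\<close> rotated by the angle \<open>t\<close>
      in the plane of the coordinates \<open>k\<close> and \<open>l\<close>; \<open>y\<close> is its
      velocity at \<open>t = 0\<close>.\<close>
    define x where "x = (\<lambda>t i. if i = k then u k * cos t - u l * sin t
      else if i = l then u k * sin t + u l * cos t else u i)"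
    define y where "y = (\<lambda>i. if i = k then - u l else if i = l then u k else 0)"
    have x0: "x 0 = u"
      by (auto simp: x_def)
    have "(\<Sum>i\<in>I. x t i ^ 2) = S" for t
    proof -
      have split: "(\<Sum>i\<in>I. f i) = f k + f l + (\<Sum>i\<in>I - {k} - {l}. f i)" for f :: "'a \<Rightarrow> real"
        using fin kl False by (simp add: sum.remove[of I k] sum.remove[of "I - {k}" l])
      have rot: "(p * c - q * s)\<^sup>2 + (p * s + q * c)\<^sup>2 = (p\<^sup>2 + q\<^sup>2) * (s\<^sup>2 + c\<^sup>2)"
        for p q s c :: real
        by (simp add: power2_eq_square algebra_simps)
      have "x t k ^ 2 + x t l ^ 2 = (u k * cos t - u l * sin t)\<^sup>2 + (u k * sin t + u l * cos t)\<^sup>2"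
        using False by (simp add: x_def)
      also have "\<dots> = u k ^ 2 + u l ^ 2"
        unfolding rot by simp
      finally have "x t k ^ 2 + x t l ^ 2 = u k ^ 2 + u l ^ 2" .
      moreover have "(\<Sum>i\<in>I - {k} - {l}. x t i ^ 2) = (\<Sum>i\<in>I - {k} - {l}. u i ^ 2)"
        by (intro sum.cong) (auto simp: x_def)
      ultimately show ?thesis
        using u unfolding split[of "\<lambda>i. x t i ^ 2"] split[of "\<lambda>i. u i ^ 2"] by simp
    qed
    then have min: "energy I A \<beta> (x 0) \<le> energy I A \<beta> (x t)" for t
      using umin x0 by simp
    have "((\<lambda>t. x t i) has_real_derivative y i) (at 0)" for i
      unfolding x_def y_def by (auto intro!: derivative_eq_intros)
    then have "((\<lambda>t. energy I A \<beta> (x t)) has_real_derivative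
        2 * (\<Sum>i\<in>I. y i * ((\<Sum>j\<in>I. A i j * x 0 j) + \<beta> * x 0 i ^ 3))) (at 0)"
      by (intro energy_has_derivative_along fin sym)
    then have "2 * (\<Sum>i\<in>I. y i * ((\<Sum>j\<in>I. A i j * x 0 j) + \<beta> * x 0 i ^ 3)) = 0"
      by (rule DERIV_local_min[of _ _ _ 1]) (auto intro: min)
    then have "(\<Sum>i\<in>I. y i * G i) = 0"
      by (simp add: x0 G_def)
    then show ?thesis
      using sum_delta2[OF fin kl False, of "- u l" "u k" G] by (simp add: y_def mult.commute)
  qed simp
  show thesis
  proof
    show "u i \<ge> 0" for i
      by (simp add: u_def)
    show "(\<Sum>i\<in>I. u i ^ 2) = S"
      by (fact u)
    \<comment> \<open>The multiplier comes from multiplying \<open>crit\<close> by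
      \<open>u j\<close> and summing over \<open>j\<close>. Only \<open>S\<close> is divided by, so
      zero entries of \<open>u\<close> do no harm.\<close>
    show "(\<Sum>j\<in>I. A i j * u j) + \<beta> * u i ^ 3 = (\<Sum>j\<in>I. G j * u j) / S * u i"
      if i: "i \<in> I" for i
    proof -
      have "G i * S = (\<Sum>j\<in>I. (G i * u j) * u j)"
        unfolding u[symmetric] by (simp add: sum_distrib_left power2_eq_square mult.assoc)
      also have "\<dots> = (\<Sum>j\<in>I. (G j * u i) * u j)"
        by (intro sum.cong refl) (simp add: crit i)
      also have "\<dots> = (\<Sum>j\<in>I. G j * u j) * u i"
        by (simp add: sum_distrib_left mult_ac)
      finally show ?thesis
        using S by (simp add: G_def field_simps)
    qed
  qed
qed

section \<open>Comparison and uniqueness of positive solutions\<close>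

text \<open>At an index \<open>k\<close> where \<open>u / w\<close> attains its maximum
  \<open>t\<close>, the vector \<open>t w\<close> touches \<open>u\<close> from above. Comparing the
  equations in row \<open>k\<close> bounds \<open>\<beta> ((t w k)^2 - (w k)^2)\<close> by
  \<open>lam - mu\<close>, which is at most 0, hence \<open>t \<le> 1\<close>.\<close>

lemma pos_eigenvector_mono:
  fixes A :: "'a \<Rightarrow> 'a \<Rightarrow> real"
  assumes fin: "finite I" and \<beta>: "\<beta> > 0"
    and offdiag: "\<And>i j. i \<in> I \<Longrightarrow> j \<in> I \<Longrightarrow> i \<noteq> j \<Longrightarrow> A i j \<le> 0"
    and u: "\<And>i. i \<in> I \<Longrightarrow> u i > 0" and w: "\<And>i. i \<in> I \<Longrightarrow> w i > 0"
    and eu: "\<And>i. i \<in> I \<Longrightarrow> (\<Sum>j\<in>I. A i j * u j) + \<beta> * u i ^ 3 = lam * u i"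
    and ew: "\<And>i. i \<in> I \<Longrightarrow> (\<Sum>j\<in>I. A i j * w j) + \<beta> * w i ^ 3 = mu * w i"
    and le: "lam \<le> mu" and i: "i \<in> I"
  shows "u i \<le> w i"
proof -
  have "Max ((\<lambda>j. u j / w j) ` I) \<in> (\<lambda>j. u j / w j) ` I"
    using fin i by (intro Max_in) auto
  then obtain k where k: "k \<in> I" and Max: "Max ((\<lambda>j. u j / w j) ` I) = u k / w k"
    by auto
  then have max: "u j / w j \<le> u k / w k" if "j \<in> I" for j
    unfolding Max[symmetric] using fin that by simp
  define t where "t = u k / w k"
  have t: "t > 0" and uk: "u k = t * w k"
    using u[OF k] w[OF k] by (auto simp: t_def)
  have ut: "u j \<le> t * w j" if "j \<in> I" for j
    using max[OF that] w[OF that] by (simp add: t_def pos_divide_le_eq)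
  \<comment> \<open>The diagonal terms agree because \<open>u k = t * w k\<close>; elsewhere the
    nonpositive coefficients reverse \<open>u j \<le> t * w j\<close>.\<close>
  have "(\<Sum>j\<in>I. A k j * (t * w j)) \<le> (\<Sum>j\<in>I. A k j * u j)"
  proof (rule sum_mono)
    fix j assume "j \<in> I"
    then show "A k j * (t * w j) \<le> A k j * u j"
      using offdiag[OF k, of j] ut[of j] uk by (cases "j = k") (auto intro: mult_left_mono_neg)
  qed
  then have "t * (\<Sum>j\<in>I. A k j * w j) \<le> (\<Sum>j\<in>I. A k j * u j)"
    by (simp add: sum_distrib_left mult_ac)
  then have "t * (mu * w k - \<beta> * w k ^ 3) \<le> lam * u k - \<beta> * u k ^ 3"
    unfolding eq_diff_eq[THEN iffD2, OF eu[OF k]]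
      eq_diff_eq[THEN iffD2, OF ew[OF k]] .
  then have "(t * w k) * (\<beta> * ((t * w k)\<^sup>2 - (w k)\<^sup>2)) \<le> (t * w k) * (lam - mu)"
    unfolding uk by (simp add: algebra_simps power2_eq_square power3_eq_cube)
  then have "\<beta> * ((t * w k)\<^sup>2 - (w k)\<^sup>2) \<le> lam - mu"
    using t w[OF k] by simp
  then have "\<beta> * ((t * w k)\<^sup>2 - (w k)\<^sup>2) \<le> 0"
    using le by simp
  then have "(t * w k)\<^sup>2 \<le> (w k)\<^sup>2"
    using \<beta> by (simp add: mult_le_0_iff)
  then have "t * w k \<le> w k"
    by (rule power2_le_imp_le) (use w[OF k] in simp)
  then have "t \<le> 1"
    using w[OF k] by simp
  then show ?thesis
    using ut[OF i] w[OF i] mult_right_mono[of t 1 "w i"] by linarith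
qed

text \<open>The multipliers may differ a priori: the vector with the smaller one lies below the
  other entrywise, and equal sums of squares then leave no room for a strict inequality.\<close>

lemma pos_eigenvector_unique:
  fixes A :: "'a \<Rightarrow> 'a \<Rightarrow> real"
  assumes fin: "finite I" and \<beta>: "\<beta> > 0"
    and offdiag: "\<And>i j. i \<in> I \<Longrightarrow> j \<in> I \<Longrightarrow> i \<noteq> j \<Longrightarrow> A i j \<le> 0"
    and u: "\<And>i. i \<in> I \<Longrightarrow> u i > 0" and w: "\<And>i. i \<in> I \<Longrightarrow> w i > 0"
    and eu: "\<And>i. i \<in> I \<Longrightarrow> (\<Sum>j\<in>I. A i j * u j) + \<beta> * u i ^ 3 = lam * u i"
    and ew: "\<And>i. i \<in> I \<Longrightarrow> (\<Sum>j\<in>I. A i j * w j) + \<beta> * w i ^ 3 = mu * w i"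
    and norm: "(\<Sum>i\<in>I. u i ^ 2) = (\<Sum>i\<in>I. w i ^ 2)" and i: "i \<in> I"
  shows "u i = w i"
proof -
  have *: "f i = g i" if f: "\<And>i. i \<in> I \<Longrightarrow> f i > 0" and le: "\<And>i. i \<in> I \<Longrightarrow> f i \<le> g i"
    and eq: "(\<Sum>i\<in>I. f i ^ 2) = (\<Sum>i\<in>I. g i ^ 2)" for f g :: "'a \<Rightarrow> real"
  proof -
    have "f j ^ 2 \<le> g j ^ 2" if "j \<in> I" for j
      using f[OF that] le[OF that] by (simp add: power_mono)
    then have "f i ^ 2 = g i ^ 2"
      using sum_mono_inv[OF eq _ i fin] by blast
    then show ?thesis
      using f[OF i] le[OF i] by (simp add: power2_eq_iff)
  qed
  show ?thesis
  proof (cases "lam \<le> mu")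
    case True
    from pos_eigenvector_mono[OF fin \<beta> offdiag u w eu ew this]
    show ?thesis
      using * u norm by blast
  next
    case False
    then have "mu \<le> lam"
      by simp
    from pos_eigenvector_mono[OF fin \<beta> offdiag w u ew eu this]
    show ?thesis
      using *[of w u] w norm by simp
  qed
qed

section \<open>Tridiagonal matrices\<close>

text \<open>The size is left to the range of summation, so one function describes both the full
  matrix and its half-size reduction, each indexed from 1.\<close>

definition tridiag :: "real \<Rightarrow> (nat \<Rightarrow> real) \<Rightarrow> nat \<Rightarrow> nat \<Rightarrow> real" where
  "tridiag c d i j = (if i = j then d i else if i = Suc j \<or> j = Suc i then - c else 0)"

lemma tridiag_row:
  assumes i: "i \<in> {1..m}"
  shows "(\<Sum>j=1..m. tridiag c d i j * u j)
    = d i * u i - c * ((if i = 1 then 0 else u (i - 1)) + (if i = m then 0 else u (i + 1)))"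
proof -
  \<comment> \<open>Splitting into three deltas handles the ends: for \<open>i = 1\<close> the left
    delta sits at 0 and for \<open>i = m\<close> the right one at \<open>m + 1\<close>, both outside
    \<open>{1..m}\<close>.\<close>
  have "(\<Sum>j=1..m. tridiag c d i j * u j)
      = (\<Sum>j=1..m. (if j = i then d i * u i else 0) + (if j = i - 1 then - c * u (i - 1) else 0)
          + (if j = i + 1 then - c * u (i + 1) else 0))"
    using i by (intro sum.cong) (auto simp: tridiag_def)
  also have "\<dots> = d i * u i + (if i = 1 then 0 else - c * u (i - 1))
      + (if i = m then 0 else - c * u (i + 1))"
    using i unfolding sum.distrib by (auto simp: sum.delta)
  finally show ?thesis
    by (simp add: algebra_simps)
qed

text \<open>A zero spreads: in a row \<open>k\<close> with \<open>u k = 0\<close> the equation says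
  that the neighbours sum to 0, and being nonnegative they vanish too. Along the chain this reaches
  every index and contradicts the positive norm.\<close>

lemma tridiag_nonneg_eigenvector_pos:
  assumes c: "c > 0" and nonneg: "\<And>i. u i \<ge> 0" and norm: "(\<Sum>i=1..m. u i ^ 2) > 0"
    and eq: "\<And>i. i \<in> {1..m} \<Longrightarrow> (\<Sum>j=1..m. tridiag c d i j * u j) + \<beta> * u i ^ 3 = lam * u i"
    and i: "i \<in> {1..m}"
  shows "u i > 0"
proof (rule ccontr)
  assume "\<not> u i > 0"
  then have ui: "u i = 0"
    using nonneg[of i] by simp
  have nb: "(k = 1 \<or> u (k - 1) = 0) \<and> (k = m \<or> u (k + 1) = 0)"
    if k: "k \<in> {1..m}" and uk: "u k = 0" for k
  proof -
    have "c * ((if k = 1 then 0 else u (k - 1)) + (if k = m then 0 else u (k + 1))) = 0"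
      using eq[OF k] uk unfolding tridiag_row[OF k] by simp
    then show ?thesis
      using c nonneg[of "k - 1"] nonneg[of "k + 1"] by (auto split: if_splits)
  qed
  have up: "u k = 0" if "i \<le> k" "k \<le> m" for k
    using that
  proof (induction k rule: dec_induct)
    case (step k)
    then show ?case
      using nb[of k] i by auto
  qed (simp add: ui)
  have down: "u k = 0" if "k \<le> i" "1 \<le> k" for k
    using that
  proof (induction k rule: inc_induct)
    case (step k)
    then show ?case
      using nb[of "Suc k"] i by auto
  qed (simp add: ui)
  have "u k = 0" if "k \<in> {1..m}" for k
    using up[of k] down[of k] that by (cases "i \<le> k") auto
  then have "(\<Sum>i=1..m. u i ^ 2) = 0"
    by (intro sum.neutral) auto
  then show False
    using norm by simp
qed

lemma tridiag_pos_eigenvector_exists: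
  assumes c: "c > 0" and m: "m \<ge> 1" and S: "S > 0"
  obtains u lam where "\<And>i. i \<in> {1..m} \<Longrightarrow> u i > 0" and "(\<Sum>i=1..m. u i ^ 2) = S"
    and "\<And>i. i \<in> {1..m} \<Longrightarrow> (\<Sum>j=1..m. tridiag c d i j * u j) + \<beta> * u i ^ 3 = lam * u i"
proof -
  obtain u lam where u: "\<And>i. u i \<ge> 0" "(\<Sum>i=1..m. u i ^ 2) = S"
    "\<And>i. i \<in> {1..m} \<Longrightarrow> (\<Sum>j=1..m. tridiag c d i j * u j) + \<beta> * u i ^ 3 = lam * u i"
    by (rule nonneg_eigenvector_exists[where I = "{1..m}" and A = "tridiag c d" and S = S
          and \<beta> = \<beta>])
      (use c S m in \<open>auto simp: tridiag_def split: if_splits\<close>)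
  have "u i > 0" if "i \<in> {1..m}" for i
    using tridiag_nonneg_eigenvector_pos[OF c u(1) _ u(3) that] u(2) S by simp
  then show thesis
    using that u by blast
qed

section \<open>Antisymmetric vectors\<close>

text \<open>For odd \<open>n\<close> the centre \<open>(n + 1) div 2\<close> is its own mirror
  image, so its value is forced to be 0.\<close>

definition antisymmetric :: "nat \<Rightarrow> (nat \<Rightarrow> real) \<Rightarrow> bool" where
  "antisymmetric n u \<longleftrightarrow> (\<forall>j\<in>{1..n}. u (n + 1 - j) = - u j)"

lemma antisymmetricD: "antisymmetric n u \<Longrightarrow> j \<in> {1..n} \<Longrightarrow> u (n + 1 - j) = - u j"
  unfolding antisymmetric_def by blast

text \<open>For even \<open>n\<close> the right neighbour of \<open>i = n div 2\<close> is its
  mirror image, with value \<open>- u i\<close>; the contribution \<open>- c * (- u i)\<close> moves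
  to the diagonal. For odd \<open>n\<close> that neighbour is the centre, with value 0.\<close>

definition fold_diag :: "nat \<Rightarrow> real \<Rightarrow> (nat \<Rightarrow> real) \<Rightarrow> nat \<Rightarrow> real" where
  "fold_diag n c d i = d i + (if even n \<and> i = n div 2 then c else 0)"

lemma tridiag_row_fold:
  assumes anti: "antisymmetric n u" and i: "i \<in> {1..n div 2}"
  shows "(\<Sum>j=1..n. tridiag c d i j * u j)
    = (\<Sum>j=1..n div 2. tridiag c (fold_diag n c d) i j * u j)"
proof -
  have i': "i \<in> {1..n}"
    using i by auto
  have *: "u (i + 1) = (if even n then - u i else 0)" if "i = n div 2"
  proof (cases "even n")
    case True
    then have "n + 1 - i = i + 1"
      using that by auto
    then show ?thesis
      using antisymmetricD[OF anti i'] True by simp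
  next
    case False
    then have "n + 1 - (i + 1) = i + 1" "i + 1 \<in> {1..n}"
      using that by (auto elim!: oddE)
    then show ?thesis
      using antisymmetricD[OF anti, of "i + 1"] False by simp
  qed
  have "i \<noteq> n"
    using i by auto
  then show ?thesis
    unfolding tridiag_row[OF i] tridiag_row[OF i'] using *
    by (auto simp: fold_diag_def algebra_simps)
qed

text \<open>Reflection exchanges left and right neighbours as well as the two ends of the range; the
  diagonal entry is kept, so every term changes sign.\<close>

lemma tridiag_row_reflect:
  assumes anti: "antisymmetric n u" and i: "i \<in> {1..n}"
    and d: "d (n + 1 - i) = d i"
  shows "(\<Sum>j=1..n. tridiag c d (n + 1 - i) j * u j) = - (\<Sum>j=1..n. tridiag c d i j * u j)"
proof -
  have i': "n + 1 - i \<in> {1..n}"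
    using i by auto
  have "u (n + 1 - i - 1) = - u (i + 1)" if "i \<noteq> n"
    using antisymmetricD[OF anti, of "i + 1"] i that by auto
  moreover have "u (n + 1 - i + 1) = - u (i - 1)" if "i \<noteq> 1"
  proof -
    have "n + 1 - i + 1 = n + 1 - (i - 1)" and "i - 1 \<in> {1..n}"
      using i that by auto
    then show ?thesis
      using antisymmetricD[OF anti, of "i - 1"] by simp
  qed
  moreover have "n + 1 - i = 1 \<longleftrightarrow> i = n" "n + 1 - i = n \<longleftrightarrow> i = 1"
    using i by auto
  ultimately show ?thesis
    unfolding tridiag_row[OF i] tridiag_row[OF i'] using d antisymmetricD[OF anti i]
    by (cases "i = n"; cases "i = 1") (auto simp: algebra_simps)
qed

lemma reflect_cases:
  assumes "i \<in> {1..n::nat}"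
  obtains "i \<in> {1..n div 2}" | "n + 1 - i \<in> {1..n div 2}" | "odd n" "i = (n + 1) div 2" "n + 1 - i = i"
proof -
  have "i \<in> {1..n div 2} \<or> n + 1 - i \<in> {1..n div 2} \<or> odd n \<and> i = (n + 1) div 2 \<and> n + 1 - i = i"
    using assms by simp presburger
  then show thesis
    using that by blast
qed

text \<open>Cubing is odd, so the equations in mirror rows are negatives of each other, and the one
  in the centre reads \<open>0 = 0\<close>. What remains is the left half, in folded form.\<close>

lemma antisym_eigenvector_iff:
  assumes anti: "antisymmetric n u"
    and d: "\<And>j. j \<in> {1..n} \<Longrightarrow> d (n + 1 - j) = d j"
  shows "(\<forall>i\<in>{1..n}. (\<Sum>j=1..n. tridiag c d i j * u j) + \<beta> * u i ^ 3 = lam * u i) \<longleftrightarrow>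
    (\<forall>i\<in>{1..n div 2}. (\<Sum>j=1..n div 2. tridiag c (fold_diag n c d) i j * u j) + \<beta> * u i ^ 3
        = lam * u i)"
    (is "(\<forall>i\<in>_. ?P i) \<longleftrightarrow> ?R")
proof -
  have reflect: "?P (n + 1 - i) \<longleftrightarrow> ?P i" if i: "i \<in> {1..n}" for i
    unfolding tridiag_row_reflect[where d = d, OF anti i d[OF i]] antisymmetricD[OF anti i]
    by (auto simp: algebra_simps)
  \<comment> \<open>At a fixed index of the reflection the row sum equals its own negative, and so
    does \<open>u i\<close>; both are 0.\<close>
  have mid: "?P i" if i: "i \<in> {1..n}" and "n + 1 - i = i" for i
    using tridiag_row_reflect[where d = d, OF anti i d[OF i]] antisymmetricD[OF anti i] that by simp
  have "?R \<longleftrightarrow> (\<forall>i\<in>{1..n div 2}. ?P i)"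
    by (intro ball_cong refl) (simp only: tridiag_row_fold[OF anti])
  moreover have "?P i" if "\<forall>i\<in>{1..n div 2}. ?P i" "i \<in> {1..n}" for i
    using that(2) by (cases rule: reflect_cases) (use that reflect[of i] mid[of i] in blast)+
  moreover have "{1..n div 2} \<subseteq> {1..n}"
    by auto
  ultimately show ?thesis
    by blast
qed

lemma antisym_sum_squares:
  fixes u :: "nat \<Rightarrow> real"
  assumes anti: "antisymmetric n u"
  shows "(\<Sum>i=1..n. u i ^ 2) = 2 * (\<Sum>i=1..n div 2. u i ^ 2)"
proof -
  let ?L = "{1..n div 2}" and ?R = "(\<lambda>i. n + 1 - i) ` {1..n div 2}"
  have inj: "inj_on (\<lambda>i. n + 1 - i) ?L"
    by (auto simp: inj_on_def)
  \<comment> \<open>The left half and its mirror image miss at most the centre of an odd range,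
    where \<open>u\<close> vanishes.\<close>
  have "(\<Sum>i=1..n. u i ^ 2) = (\<Sum>i\<in>?L \<union> ?R. u i ^ 2)"
  proof (rule sum.mono_neutral_right)
    show "\<forall>i\<in>{1..n} - (?L \<union> ?R). u i ^ 2 = 0"
    proof
      fix i assume i: "i \<in> {1..n} - (?L \<union> ?R)"
      then have "i \<in> {1..n}" and "i = n + 1 - (n + 1 - i)"
        by auto
      then show "u i ^ 2 = 0"
      proof (cases rule: reflect_cases)
        case 3
        then show ?thesis
          using antisymmetricD[OF anti, of i] i by simp
      qed (use i in blast)+
    qed
  qed auto
  also have "\<dots> = (\<Sum>i\<in>?L. u i ^ 2) + (\<Sum>i\<in>?R. u i ^ 2)"
    by (rule sum.union_disjoint) auto
  also have "(\<Sum>i\<in>?R. u i ^ 2) = (\<Sum>i\<in>?L. u (n + 1 - i) ^ 2)"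
    unfolding sum.reindex[OF inj] by simp
  also have "\<dots> = (\<Sum>i\<in>?L. u i ^ 2)"
  proof (rule sum.cong)
    fix i assume "i \<in> ?L"
    then have "i \<in> {1..n}"
      by auto
    from antisymmetricD[OF anti this] show "u (n + 1 - i) ^ 2 = u i ^ 2"
      by simp
  qed simp
  finally show ?thesis
    by simp
qed

section \<open>The discretized problem\<close>

text \<open>With \<open>h\<close> the grid step, halving the entries \<open>- 1 / h^2\<close> and
  \<open>2 / h^2\<close> of \<open>D1_mat\<close> gives \<open>- off_coeff a n\<close> and
  \<open>2 * off_coeff a n\<close>.\<close>

definition off_coeff :: "real \<Rightarrow> nat \<Rightarrow> real" where
  "off_coeff a n = 1 / (2 * grid_step a n ^ 2)"

definition diag_coeff :: "real \<Rightarrow> nat \<Rightarrow> nat \<Rightarrow> real" where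
  "diag_coeff a n i = 2 * off_coeff a n + potential (grid_point a n i)"

text \<open>As \<open>n + 1\<close> steps make up the length \<open>2 * a\<close>, replacing
  \<open>j\<close> by \<open>n + 1 - j\<close> turns \<open>- a + j * h\<close> into
  \<open>a - j * h\<close>. With the even potential this makes the diagonal symmetric.\<close>

lemma grid_point_reflect:
  assumes "j \<le> n + 1"
  shows "grid_point a n (n + 1 - j) = - grid_point a n j"
  using assms by (simp add: grid_point_def grid_step_def of_nat_diff field_simps)

lemma diag_coeff_reflect: "j \<le> n + 1 \<Longrightarrow> diag_coeff a n (n + 1 - j) = diag_coeff a n j"
  by (simp only: diag_coeff_def grid_point_reflect potential_def power2_minus)

lemma D_mat_index:
  "i < n \<Longrightarrow> j < n \<Longrightarrow>
    D_mat a n $$ (i, j) = tridiag (off_coeff a n) (diag_coeff a n) (Suc i) (Suc j)"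
  by (auto simp: D_mat_def D1_mat_def tridiag_def off_coeff_def diag_coeff_def mat_diag_def)

lemma D_mat_carrier: "D_mat a n \<in> carrier_mat n n"
  by (simp add: D_mat_def D1_mat_def mat_diag_def)

text \<open>Passes to sums indexed from 1, where reflection is \<open>n + 1 - j\<close>. The
  normalisation leaves the existential because it does not involve the multiplier.\<close>

lemma is_solution_iff:
  "is_solution \<beta> a n \<phi> \<longleftrightarrow> \<phi> \<in> carrier_vec n \<and>
    (\<exists>lam. \<forall>i\<in>{1..n}. (\<Sum>j=1..n. tridiag (off_coeff a n) (diag_coeff a n) i j * component \<phi> j)
        + \<beta> * component \<phi> i ^ 3 = lam * component \<phi> i) \<and>
    (\<Sum>i=1..n. component \<phi> i ^ 2) = 1 / grid_step a n"
proof (cases "\<phi> \<in> carrier_vec n")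
  case True
  have shift: "(\<Sum>j=1..n. f j) = (\<Sum>j<n. f (Suc j))" for f :: "nat \<Rightarrow> real"
    using sum.atLeast1_atMost_eq[of f n] by simp
  have "\<phi> \<bullet> \<phi> = (\<Sum>i=1..n. component \<phi> i ^ 2)"
    unfolding shift using True
    by (simp add: scalar_prod_def component_def power2_eq_square atLeast0LessThan)
  moreover have "D_mat a n *\<^sub>v \<phi> + \<beta> \<cdot>\<^sub>v vec_cube \<phi> - lam \<cdot>\<^sub>v \<phi> = 0\<^sub>v n \<longleftrightarrow>
     (\<forall>i\<in>{1..n}. (\<Sum>j=1..n. tridiag (off_coeff a n) (diag_coeff a n) i j * component \<phi> j)
        + \<beta> * component \<phi> i ^ 3 = lam * component \<phi> i)" for lam
  proof -
    have row: "(D_mat a n *\<^sub>v \<phi>) $ i =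
        (\<Sum>j=1..n. tridiag (off_coeff a n) (diag_coeff a n) (Suc i) j * component \<phi> j)"
      if "i < n" for i
      unfolding shift using True that D_mat_carrier[of a n]
      by (simp add: scalar_prod_def component_def atLeast0LessThan D_mat_index)
    have "D_mat a n *\<^sub>v \<phi> + \<beta> \<cdot>\<^sub>v vec_cube \<phi> - lam \<cdot>\<^sub>v \<phi> = 0\<^sub>v n \<longleftrightarrow>
       (\<forall>i<n. (D_mat a n *\<^sub>v \<phi>) $ i + \<beta> * \<phi> $ i ^ 3 - lam * \<phi> $ i = 0)"
      using True D_mat_carrier[of a n] by (auto simp: vec_eq_iff vec_cube_def)
    also have "\<dots> \<longleftrightarrow> (\<forall>i\<in>Suc ` {..<n}.
        (\<Sum>j=1..n. tridiag (off_coeff a n) (diag_coeff a n) i j * component \<phi> j)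
        + \<beta> * component \<phi> i ^ 3 = lam * component \<phi> i)"
      by (auto simp: row component_def)
    finally show ?thesis
      by (simp add: image_Suc_lessThan)
  qed
  ultimately show ?thesis
    using True by (auto simp: is_solution_def)
qed (auto simp: is_solution_def)

text \<open>Both parities at once: the condition on the centre is present only for odd
  \<open>n\<close>, and \<open>n \<ge> 2\<close> makes the left half nonempty. Antisymmetry reduces
  everything to the positive problem of size \<open>n div 2\<close>.\<close>

lemma antisym_solution_ex1:
  assumes \<beta>: "\<beta> > 0" and a: "a > 0" and n: "n \<ge> 2"
  shows "\<exists>!\<phi>. is_solution \<beta> a n \<phi> \<and>
    (\<forall>j\<in>{1..n div 2}. component \<phi> j = - component \<phi> (n + 1 - j)) \<and>
    (odd n \<longrightarrow> component \<phi> ((n + 1) div 2) = 0) \<and>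
    (\<forall>j\<in>{1..n div 2}. component \<phi> j > 0)"
proof -
  define m where "m = n div 2"
  define c where "c = off_coeff a n"
  \<comment> \<open>Half of the prescribed \<open>1 / h\<close>, because the two halves contribute
    equally to the norm.\<close>
  define S where "S = 1 / (2 * grid_step a n)"
  have h: "grid_step a n > 0"
    using a by (simp add: grid_step_def)
  then have c: "c > 0" and S: "S > 0"
    by (auto simp: c_def S_def off_coeff_def)
  let ?anti = "\<lambda>\<phi>. antisymmetric n (component \<phi>)"
  let ?A = "tridiag c (fold_diag n c (diag_coeff a n))"
  let ?eq = "\<lambda>u lam. \<forall>i\<in>{1..m}. (\<Sum>j=1..m. ?A i j * u j) + \<beta> * u i ^ 3 = lam * u i"
  have anti: "?anti \<phi> \<longleftrightarrow> (\<forall>j\<in>{1..n div 2}. component \<phi> j = - component \<phi> (n + 1 - j)) \<and>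
      (odd n \<longrightarrow> component \<phi> ((n + 1) div 2) = 0)" (is "_ \<longleftrightarrow> ?R") for \<phi>
  proof
    assume *: "?anti \<phi>"
    have "component \<phi> ((n + 1) div 2) = 0" if "odd n"
    proof -
      have "n + 1 - (n + 1) div 2 = (n + 1) div 2" "(n + 1) div 2 \<in> {1..n}"
        using that by (auto elim!: oddE)
      then show ?thesis
        using antisymmetricD[OF *, of "(n + 1) div 2"] by simp
    qed
    moreover have "{1..n div 2} \<subseteq> {1..n}"
      by auto
    ultimately show ?R
      using antisymmetricD[OF *] by fastforce
  next
    assume *: ?R
    show "?anti \<phi>"
      unfolding antisymmetric_def
    proof
      fix j assume j: "j \<in> {1..n}"
      then have jj: "n + 1 - (n + 1 - j) = j"
        by auto
      from j show "component \<phi> (n + 1 - j) = - component \<phi> j"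
      proof (cases rule: reflect_cases)
        case 1
        then show ?thesis using * by simp
      next
        case 2
        then show ?thesis using * jj by metis
      next
        case 3
        then show ?thesis using * by simp
      qed
    qed
  qed
  have sol: "is_solution \<beta> a n \<phi> \<longleftrightarrow> \<phi> \<in> carrier_vec n \<and> (\<exists>lam. ?eq (component \<phi>) lam) \<and>
      (\<Sum>i=1..m. component \<phi> i ^ 2) = S" if u: "?anti \<phi>" for \<phi>
  proof -
    have d: "diag_coeff a n (n + 1 - j) = diag_coeff a n j" if "j \<in> {1..n}" for j
      using that by (intro diag_coeff_reflect) auto
    have row: "(\<forall>i\<in>{1..n}. (\<Sum>j=1..n. tridiag c (diag_coeff a n) i j * component \<phi> j)
        + \<beta> * component \<phi> i ^ 3 = lam * component \<phi> i) \<longleftrightarrow> ?eq (component \<phi>) lam" for lam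
      unfolding m_def by (rule antisym_eigenvector_iff[where d = "diag_coeff a n", OF u d])
    have norm: "(\<Sum>i=1..n. component \<phi> i ^ 2) = 1 / grid_step a n \<longleftrightarrow>
        (\<Sum>i=1..m. component \<phi> i ^ 2) = S"
      unfolding antisym_sum_squares[OF u] m_def S_def using h by (auto simp: field_simps)
    show ?thesis
      unfolding is_solution_iff c_def[symmetric] row norm by (rule refl)
  qed
  have "\<exists>!\<phi>. is_solution \<beta> a n \<phi> \<and> ?anti \<phi> \<and> (\<forall>j\<in>{1..m}. component \<phi> j > 0)"
  proof (rule ex_ex1I)
    have "m \<ge> 1"
      using n by (simp add: m_def)
    obtain u lam where u: "\<And>i. i \<in> {1..m} \<Longrightarrow> u i > 0" "(\<Sum>i=1..m. u i ^ 2) = S"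
      "\<And>i. i \<in> {1..m} \<Longrightarrow> (\<Sum>j=1..m. ?A i j * u j) + \<beta> * u i ^ 3 = lam * u i"
      using tridiag_pos_eigenvector_exists[OF c \<open>m \<ge> 1\<close> S,
          where d = "fold_diag n c (diag_coeff a n)" and \<beta> = \<beta>] by blast
    \<comment> \<open>The odd extension of \<open>u\<close>. Entry \<open>i\<close> belongs to
      number \<open>i + 1\<close>, whose mirror number is \<open>n - i\<close>; the final 0 is met
      only at the centre of an odd range.\<close>
    define \<phi> where "\<phi> = vec n (\<lambda>i. if Suc i \<le> m then u (Suc i)
      else if n - i \<le> m then - u (n - i) else 0)"
    have comp: "component \<phi> j =
        (if j \<le> m then u j else if n + 1 - j \<le> m then - u (n + 1 - j) else 0)"
      if "j \<in> {1..n}" for j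
      using that by (cases j) (auto simp: component_def \<phi>_def)
    then have comp_m: "component \<phi> j = u j" if "j \<in> {1..m}" for j
      using that by (auto simp: m_def)
    have "?anti \<phi>"
      unfolding antisymmetric_def
    proof
      fix j assume j: "j \<in> {1..n}"
      \<comment> \<open>The last fact holds since \<open>2 * m \<le> n\<close>: a number and its
        mirror image never both lie in the left half, so the conditionals do not collide.\<close>
      then have j': "n + 1 - j \<in> {1..n}" "n + 1 - (n + 1 - j) = j" "\<not> (j \<le> m \<and> n + 1 - j \<le> m)"
        by (auto simp: m_def)
      show "component \<phi> (n + 1 - j) = - component \<phi> j"
        unfolding comp[OF j] comp[OF j'(1)] j'(2) using j'(3) by auto
    qed
    moreover have "?eq (component \<phi>) lam"
      using u(3) by (simp add: comp_m)
    moreover have "(\<Sum>i=1..m. component \<phi> i ^ 2) = S"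
      using u(2) by (simp add: comp_m)
    moreover have "\<phi> \<in> carrier_vec n"
      by (simp add: \<phi>_def)
    ultimately have "is_solution \<beta> a n \<phi> \<and> ?anti \<phi>"
      using sol by blast
    then show "\<exists>\<phi>. is_solution \<beta> a n \<phi> \<and> ?anti \<phi> \<and> (\<forall>j\<in>{1..m}. component \<phi> j > 0)"
      using u(1) comp_m by (intro exI[of _ \<phi>]) simp
  next
    fix \<phi> \<psi>
    assume \<phi>: "is_solution \<beta> a n \<phi> \<and> ?anti \<phi> \<and> (\<forall>j\<in>{1..m}. component \<phi> j > 0)"
      and \<psi>: "is_solution \<beta> a n \<psi> \<and> ?anti \<psi> \<and> (\<forall>j\<in>{1..m}. component \<psi> j > 0)"
    obtain lam where \<phi>': "\<phi> \<in> carrier_vec n" "?eq (component \<phi>) lam"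
      "(\<Sum>i=1..m. component \<phi> i ^ 2) = S"
      using sol[of \<phi>] \<phi> by blast
    obtain mu where \<psi>': "\<psi> \<in> carrier_vec n" "?eq (component \<psi>) mu"
      "(\<Sum>i=1..m. component \<psi> i ^ 2) = S"
      using sol[of \<psi>] \<psi> by blast
    \<comment> \<open>Uniqueness for the positive half-size problem applies although
      \<open>lam\<close> and \<open>mu\<close> are not known to be equal.\<close>
    have half: "component \<phi> i = component \<psi> i" if "i \<in> {1..m}" for i
    proof (rule pos_eigenvector_unique[of "{1..m}" \<beta> ?A _ _ lam mu])
      show "?A i j \<le> 0" if "i \<noteq> j" for i j
        using that c by (simp add: tridiag_def)
    qed (use \<beta> \<phi> \<psi> \<phi>' \<psi>' that in auto)
    have "component \<phi> j = component \<psi> j" if j: "j \<in> {1..n}" for j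
      using j
    proof (cases rule: reflect_cases)
      case 1
      then show ?thesis using half by (simp add: m_def)
    next
      case 2
      then have "component \<phi> (n + 1 - j) = component \<psi> (n + 1 - j)"
        using half by (simp add: m_def)
      then show ?thesis
        using \<phi> \<psi> antisymmetricD[OF _ j, of "component \<phi>"]
          antisymmetricD[OF _ j, of "component \<psi>"]
        by (simp del: Suc_diff_le)
    next
      case 3
      then show ?thesis
        using \<phi> \<psi> anti[of \<phi>] anti[of \<psi>] by simp
    qed
    then have "component \<phi> (Suc i) = component \<psi> (Suc i)" if "i < n" for i
      using that by simp
    then show "\<phi> = \<psi>"
      using \<phi>'(1) \<psi>'(1) by (intro eq_vecI) (auto simp: component_def)
  qed
  then show ?thesis
    unfolding anti m_def by (simp only: conj_assoc)
qed

theorem theorem2p6: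
  fixes \<beta> a :: real and n :: nat
  assumes "\<beta> > 0" and "a > 0" and "n \<ge> 1"
  shows
    "(n \<ge> 3 \<and> odd n \<and>
      (\<forall>j \<in> {1..(n - 1) div 2}. grid_point a n j = - grid_point a n (n + 1 - j)) \<and>
      grid_point a n ((n + 1) div 2) = 0
      \<longrightarrow> (\<exists>!\<phi>. is_solution \<beta> a n \<phi> \<and>
            (\<forall>j \<in> {1..(n - 1) div 2}. component \<phi> j = - component \<phi> (n + 1 - j)) \<and>
            component \<phi> ((n + 1) div 2) = 0 \<and>
            (\<forall>j \<in> {1..(n - 1) div 2}. component \<phi> j > 0)))
     \<and>
     (even n \<and>
      (\<forall>j \<in> {1..n div 2}. grid_point a n j = - grid_point a n (n + 1 - j))
      \<longrightarrow> (\<exists>!\<phi>. is_solution \<beta> a n \<phi> \<and>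
            (\<forall>j \<in> {1..n div 2}. component \<phi> j = - component \<phi> (n + 1 - j)) \<and>
            (\<forall>j \<in> {1..n div 2}. component \<phi> j > 0)))"
proof (intro conjI impI; elim conjE)
  assume "n \<ge> 3" "odd n"
  \<comment> \<open>Brings the bound for odd \<open>n\<close> to the form shared by both
    parities.\<close>
  then have "(n - 1) div 2 = n div 2"
    by (auto elim!: oddE)
  then show "\<exists>!\<phi>. is_solution \<beta> a n \<phi> \<and>
            (\<forall>j \<in> {1..(n - 1) div 2}. component \<phi> j = - component \<phi> (n + 1 - j)) \<and>
            component \<phi> ((n + 1) div 2) = 0 \<and>
            (\<forall>j \<in> {1..(n - 1) div 2}. component \<phi> j > 0)"
    using antisym_solution_ex1[OF assms(1,2), of n] \<open>n \<ge> 3\<close> \<open>odd n\<close> by simp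
next
  assume "even n"
  then have "n \<ge> 2"
    using assms(3) by (cases "n = 1") auto
  then show "\<exists>!\<phi>. is_solution \<beta> a n \<phi> \<and>
            (\<forall>j \<in> {1..n div 2}. component \<phi> j = - component \<phi> (n + 1 - j)) \<and>
            (\<forall>j \<in> {1..n div 2}. component \<phi> j > 0)"
    using antisym_solution_ex1[OF assms(1,2), of n] \<open>even n\<close> by simp
qed

end
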